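(* Let $(X,qp_{bl})$ be a 0-complete quasi-partial b-metric-like space with coefficient $s\ge 1$. Let $T:X\to X$ be a map such that $$qp_{bl}(Tx,Ty)\le \phi(qp_{bl}(x,y))\quad\text{for all } x,y\in X,$$ where $\phi:[0,\infty)\to[0,\infty)$ is a continuous map such that $\phi(t)=0$ if and only if $t=0$, and $\phi(t)<t$ for all $t>0$. If $\sum_{n=1}^{\infty}s^n\phi^n(t)$ converges for all $t>0$, where $\phi^n$ is the $n$th iterate of $\phi$, then $T$ has a unique fixed point.
   Context: A quasi-partial b-metric-like on a non-empty set $X$ is a function $qp_{bl}:X\times X\to[0,\infty)$ such that for some real number $s\ge 1$ and all $x,y,z\in X$: (1) if $qp_{bl}(x,y)=0$ then $x=y$; (2) $qp_{bl}(x,x)\le qp_{bl}(x,y)$; (3) $qp_{bl}(x,x)\le qp_{bl}(y,x)$; (4) $qp_{bl}(x,y)\le s[qp_{bl}(x,z)+qp_{bl}(z,y)]-qp_{bl}(z,z)$. The pair $(X,qp_{bl})$ is called a quasi-partial b-metric-like space and $s$ its coefficient. A sequence $\{x_n\}\subseteq X$ is 0-Cauchy if $\lim_{n,m\to\infty}qp_{bl}(x_n,x_m)=0=\lim_{n,m\to\infty}qp_{bl}(x_m,x_n)$. The space $(X,qp_{bl})$ is 0-complete if for every 0-Cauchy sequence $\{x_n\}\subseteq X$ there exists $x\in X$ such that $\lim_{n\to\infty}qp_{bl}(x_n,x)=\lim_{n\to\infty}qp_{bl}(x,x_n)=qp_{bl}(x,x)=0=\lim_{n,m\to\infty}qp_{bl}(x_n,x_m)=\lim_{n,m\to\infty}qp_{bl}(x_m,x_n)$.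 *)

theory Defs
  imports Complex_Main "HOL-Library.FuncSet"
begin

locale quasi_partial_b_metric_like =
  fixes X :: "'a set" and qp :: "'a \<Rightarrow> 'a \<Rightarrow> real" and s :: real
  assumes nonempty: "X \<noteq> {}"
    and coeff_ge_1: "s \<ge> 1"
    and nonneg: "\<lbrakk>x \<in> X; y \<in> X\<rbrakk> \<Longrightarrow> 0 \<le> qp x y"
    and eq_if_zero: "\<lbrakk>x \<in> X; y \<in> X; qp x y = 0\<rbrakk> \<Longrightarrow> x = y"
    and self_le_right: "\<lbrakk>x \<in> X; y \<in> X\<rbrakk> \<Longrightarrow> qp x x \<le> qp x y"
    and self_le_left: "\<lbrakk>x \<in> X; y \<in> X\<rbrakk> \<Longrightarrow> qp x x \<le> qp y x"
    and triangle: "\<lbrakk>x \<in> X; y \<in> X; z \<in> X\<rbrakk> \<Longrightarrow> qp x y \<le> s * (qp x z + qp z y) - qp z z"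

text \<open>Double limits as \<open>n, m \<rightarrow> \<infinity>\<close> are joint limits, i.e. limits along the product filter
  \<open>sequentially \<times>\<^sub>F sequentially\<close>.\<close>

definition zero_Cauchy :: "'a set \<Rightarrow> ('a \<Rightarrow> 'a \<Rightarrow> real) \<Rightarrow> (nat \<Rightarrow> 'a) \<Rightarrow> bool" where
  "zero_Cauchy X qp x \<longleftrightarrow> range x \<subseteq> X
     \<and> ((\<lambda>(n, m). qp (x n) (x m)) \<longlongrightarrow> 0) (sequentially \<times>\<^sub>F sequentially)
     \<and> ((\<lambda>(n, m). qp (x m) (x n)) \<longlongrightarrow> 0) (sequentially \<times>\<^sub>F sequentially)"

definition zero_complete :: "'a set \<Rightarrow> ('a \<Rightarrow> 'a \<Rightarrow> real) \<Rightarrow> bool" where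
  "zero_complete X qp \<longleftrightarrow> (\<forall>x. zero_Cauchy X qp x \<longrightarrow>
     (\<exists>l\<in>X. (\<lambda>n. qp (x n) l) \<longlonglongrightarrow> qp l l \<and> (\<lambda>n. qp l (x n)) \<longlonglongrightarrow> qp l l \<and> qp l l = 0
       \<and> ((\<lambda>(n, m). qp (x n) (x m)) \<longlongrightarrow> 0) (sequentially \<times>\<^sub>F sequentially)
       \<and> ((\<lambda>(n, m). qp (x m) (x n)) \<longlongrightarrow> 0) (sequentially \<times>\<^sub>F sequentially)))"

end

theory Submission
  imports Defs
begin

text \<open>
  The distances \<open>a\<^sub>n = qp (T\<^sup>n x) (T\<^sup>n y)\<close> satisfy \<open>a\<^sub>n\<^sub>+\<^sub>1 \<le> \<phi> a\<^sub>n\<close>; as \<open>\<phi>\<close> may fail to be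
  monotone, this does not bound them by \<open>\<phi>\<^sup>n a\<^sub>0\<close>. Their decay rests on compactness: on
  \<open>[\<epsilon>, R]\<close> the gap \<open>t - \<phi> t\<close> has a positive minimum, so \<open>a\<^sub>n\<close> drops below \<open>\<epsilon>\<close> after a number of
  steps that depends only on \<open>\<epsilon>\<close> and on a bound \<open>R\<close> for \<open>a\<^sub>0\<close> (\<open>uniform_decay\<close>).

  This uniformity absorbs the factor \<open>s\<close> of the triangle inequality. Choose \<open>N\<close> such that \<open>T\<^sup>N\<close>
  takes pairs at distance at most \<open>\<epsilon>\<close> to pairs at distance less than \<open>\<epsilon> / (2 * s)\<close>. Once an
  orbit point \<open>u\<close> is moved by less than \<open>\<epsilon> / (2 * s)\<close> under \<open>T\<^sup>N\<close>, the triangle inequality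
  through \<open>T\<^sup>N u\<close> shows that \<open>T\<^sup>N\<close> maps the \<open>\<epsilon>\<close>-ball around \<open>u\<close> into itself. If the next \<open>N\<close> orbit
  points also lie in that ball, the whole tail is trapped in it (\<open>orbit_eventually_trapped\<close>).
  The hypotheses are invariant under
  exchanging the two arguments of \<open>qp\<close> (\<open>swap\<close>), so the same holds for distances measured backwards
  along the orbit, and the orbit is 0-Cauchy. Since \<open>T\<close> does not increase distances, its limit is
  fixed; two fixed points at positive distance \<open>d\<close> would give \<open>d \<le> \<phi> d < d\<close>.
\<close>

text \<open>
  While \<open>a\<^sub>n \<ge> \<epsilon>\<close>, each step loses at least the minimum \<open>\<delta>\<close> of the gap \<open>t - \<phi> t\<close> over \<open>[\<epsilon>, R]\<close>,
  which can happen at most \<open>R / \<delta>\<close> times; and a nonincreasing sequence that is below \<open>\<epsilon>\<close> stays there.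
\<close>

lemma uniform_decay:
  fixes \<phi> :: "real \<Rightarrow> real"
  assumes cont: "continuous_on {0..} \<phi>"
    and zero: "\<phi> 0 = 0"
    and less: "\<And>t. t > 0 \<Longrightarrow> \<phi> t < t"
    and "\<epsilon> > 0"
  obtains N where "\<And>a n. \<lbrakk>\<And>n. 0 \<le> a n; a 0 \<le> R; \<And>n. a (Suc n) \<le> \<phi> (a n); n \<ge> N\<rbrakk> \<Longrightarrow> a n < \<epsilon>"
proof -
  have "\<exists>\<delta>>0. \<forall>t\<in>{\<epsilon>..R}. \<phi> t \<le> t - \<delta>"
  proof (cases "\<epsilon> \<le> R")
    case True
    have "continuous_on {\<epsilon>..R} (\<lambda>t. t - \<phi> t)"
      using \<open>\<epsilon> > 0\<close> by (intro continuous_intros continuous_on_subset[OF cont]) auto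
    then obtain t0 where "t0 \<in> {\<epsilon>..R}" and "\<forall>t\<in>{\<epsilon>..R}. t0 - \<phi> t0 \<le> t - \<phi> t"
      using continuous_attains_inf[of "{\<epsilon>..R}" "\<lambda>t. t - \<phi> t"] True by auto
    then show ?thesis
      using less[of t0] \<open>\<epsilon> > 0\<close> by (intro exI[of _ "t0 - \<phi> t0"]) force
  next
    case False
    then show ?thesis by (auto intro: exI[of _ 1])
  qed
  then obtain \<delta> where "\<delta> > 0" and gap: "\<And>t. \<epsilon> \<le> t \<Longrightarrow> t \<le> R \<Longrightarrow> \<phi> t \<le> t - \<delta>"
    by auto
  obtain N :: nat where N: "R < real N * \<delta>"
    using reals_Archimedean3[OF \<open>\<delta> > 0\<close>] by blast
  have "a n < \<epsilon>"
    if nonneg: "\<And>n. 0 \<le> a n" and start: "a 0 \<le> R" and step: "\<And>n. a (Suc n) \<le> \<phi> (a n)"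
      and "n \<ge> N" for a n
  proof (rule ccontr)
    assume "\<not> a n < \<epsilon>"
    have "a (Suc k) \<le> a k" for k
      using step[of k] less[of "a k"] zero nonneg[of k] by (cases "a k = 0") force+
    then have "decseq a"
      by (simp add: decseq_SucI)
    have "a k \<le> R - real k * \<delta>" if "k \<le> n" for k
      using that
    proof (induction k)
      case 0
      then show ?case using start by simp
    next
      case (Suc k)
      have "\<epsilon> \<le> a k" and "a k \<le> R"
        using \<open>\<not> a n < \<epsilon>\<close> Suc.prems decseqD[OF \<open>decseq a\<close>, of k n]
          decseqD[OF \<open>decseq a\<close>, of 0 k] start by auto
      then show ?case
        using gap[of "a k"] step[of k] Suc by (simp add: algebra_simps)
    qed
    moreover have "real N * \<delta> \<le> real n * \<delta>"
      using \<open>n \<ge> N\<close> \<open>\<delta> > 0\<close> by simp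
    ultimately show False
      using N nonneg[of n] by force
  qed
  then show ?thesis by (rule that)
qed

locale gauge_contraction = quasi_partial_b_metric_like X qp s
  for X :: "'a set" and qp and s +
  fixes T :: "'a \<Rightarrow> 'a" and \<phi> :: "real \<Rightarrow> real"
  assumes self_map: "T \<in> X \<rightarrow> X"
    and gauge_cont: "continuous_on {0..} \<phi>"
    and gauge_zero: "\<phi> 0 = 0"
    and gauge_less: "\<And>t. t > 0 \<Longrightarrow> \<phi> t < t"
    and contraction: "\<And>x y. \<lbrakk>x \<in> X; y \<in> X\<rbrakk> \<Longrightarrow> qp (T x) (T y) \<le> \<phi> (qp x y)"
begin

lemma swap: "gauge_contraction X (\<lambda>x y. qp y x) s T \<phi>"
proof unfold_locales
  fix x y z assume "x \<in> X" "y \<in> X" "z \<in> X"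
  then show "qp y x \<le> s * (qp z x + qp y z) - qp z z"
    using triangle[of y x z] by (simp add: add.commute)
qed (use nonempty coeff_ge_1 nonneg self_le_left self_le_right self_map gauge_cont gauge_zero
      gauge_less contraction in \<open>auto dest: eq_if_zero\<close>)

lemma relaxed_triangle:
  assumes "x \<in> X" "y \<in> X" "z \<in> X"
  shows "qp x y \<le> s * (qp x z + qp z y)"
  using triangle[OF assms] nonneg[of z z] assms by linarith

lemma iterate_in: "x \<in> X \<Longrightarrow> (T ^^ n) x \<in> X"
  using self_map by (induction n) auto

lemma nonexpansive:
  assumes "x \<in> X" "y \<in> X"
  shows "qp (T x) (T y) \<le> qp x y"
  using contraction[OF assms] gauge_less[of "qp x y"] gauge_zero nonneg[OF assms]
  by (cases "qp x y = 0") force+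

lemma iterates_uniformly_close:
  assumes "\<epsilon> > 0"
  obtains N where
    "\<And>x y n. \<lbrakk>x \<in> X; y \<in> X; qp x y \<le> R; n \<ge> N\<rbrakk> \<Longrightarrow> qp ((T ^^ n) x) ((T ^^ n) y) < \<epsilon>"
proof -
  obtain N where N:
    "\<And>a n. \<lbrakk>\<And>n. 0 \<le> a n; a 0 \<le> R; \<And>n. a (Suc n) \<le> \<phi> (a n); n \<ge> N\<rbrakk> \<Longrightarrow> a n < \<epsilon>"
    using uniform_decay[OF gauge_cont gauge_zero gauge_less assms, of R] by blast
  show ?thesis
  proof (rule that)
    fix x y n assume "x \<in> X" "y \<in> X" "qp x y \<le> R" "n \<ge> N"
    then show "qp ((T ^^ n) x) ((T ^^ n) y) < \<epsilon>"
      by (intro N[of "\<lambda>n. qp ((T ^^ n) x) ((T ^^ n) y)"])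
        (auto intro: contraction nonneg iterate_in)
  qed
qed

lemma iterates_asymptotic:
  assumes "x \<in> X" "y \<in> X" "\<epsilon> > 0"
  shows "\<forall>\<^sub>F n in sequentially. qp ((T ^^ n) x) ((T ^^ n) y) < \<epsilon>"
  using iterates_uniformly_close[OF \<open>\<epsilon> > 0\<close>, of "qp x y"] assms
  unfolding eventually_sequentially by (metis order_refl)

text \<open>
  \<open>T\<^sup>N\<close> maps the \<open>\<epsilon>\<close>-ball around a late orbit point \<open>x\<^sub>n\<close> into itself, so it suffices that the ball
  contains the first \<open>N\<close> orbit points from \<open>x\<^sub>n\<close> on: every later one arises from these by iterating
  \<open>T\<^sup>N\<close>.
\<close>

lemma orbit_eventually_trapped:
  assumes "x \<in> X" "\<epsilon> > 0"
  obtains K where "\<And>n m. \<lbrakk>K \<le> n; n \<le> m\<rbrakk> \<Longrightarrow> qp ((T ^^ n) x) ((T ^^ m) x) \<le> \<epsilon>"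
proof -
  define \<delta> where "\<delta> = \<epsilon> / (2 * s)"
  have "\<delta> > 0" and "\<delta> \<le> \<epsilon>" and two_\<delta>: "s * (\<delta> + \<delta>) = \<epsilon>"
    using \<open>\<epsilon> > 0\<close> coeff_ge_1 by (auto simp: \<delta>_def field_simps)
  obtain N0 where N0:
    "\<And>u v n. \<lbrakk>u \<in> X; v \<in> X; qp u v \<le> \<epsilon>; n \<ge> N0\<rbrakk> \<Longrightarrow> qp ((T ^^ n) u) ((T ^^ n) v) < \<delta>"
    using iterates_uniformly_close[OF \<open>\<delta> > 0\<close>] by blast
  \<comment> \<open>The period must be positive for the descent in steps of \<open>N\<close> to terminate.\<close>
  define N where "N = Suc N0"
  have "\<forall>\<^sub>F n in sequentially. \<forall>r\<in>{..N}. qp ((T ^^ n) x) ((T ^^ n) ((T ^^ r) x)) < \<delta>"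
    using \<open>\<delta> > 0\<close> assms(1)
    by (intro eventually_ball_finite ballI iterates_asymptotic iterate_in) auto
  then obtain K where K: "\<And>n r. \<lbrakk>K \<le> n; r \<le> N\<rbrakk> \<Longrightarrow> qp ((T ^^ n) x) ((T ^^ (n + r)) x) < \<delta>"
    by (auto simp: eventually_sequentially funpow_add)
  have trapped: "qp ((T ^^ n) x) ((T ^^ (n + r)) x) \<le> \<epsilon>" if "K \<le> n" for n r
  proof (induction r rule: less_induct)
    case (less r)
    show ?case
    proof (cases "r \<le> N")
      case True
      then show ?thesis using K[OF that True] \<open>\<delta> \<le> \<epsilon>\<close> by simp
    next
      case False
      let ?u = "(T ^^ n) x" and ?v = "(T ^^ (n + (r - N))) x"
      have "qp ((T ^^ N) ?u) ((T ^^ N) ?v) < \<delta>"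
        using less.IH[of "r - N"] False assms(1)
        by (intro N0 iterate_in) (auto simp: N_def)
      moreover have "(T ^^ N) ?u = (T ^^ (n + N)) x" "(T ^^ N) ?v = (T ^^ (n + r)) x"
        using False by (simp_all flip: funpow_add comp_apply[of "T ^^ _"] add: add.commute)
      moreover have "qp ?u ((T ^^ (n + N)) x) < \<delta>"
        using K[OF that, of N] by simp
      ultimately have "s * (qp ?u ((T ^^ (n + N)) x) + qp ((T ^^ (n + N)) x) ((T ^^ (n + r)) x))
          \<le> s * (\<delta> + \<delta>)"
        using coeff_ge_1 by (intro mult_left_mono) auto
      then show ?thesis
        using relaxed_triangle[of ?u "(T ^^ (n + r)) x" "(T ^^ (n + N)) x"] assms(1) two_\<delta>
        by (force simp: iterate_in)
    qed
  qed
  show ?thesis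
  proof (rule that)
    fix n m :: nat assume "K \<le> n" "n \<le> m"
    then show "qp ((T ^^ n) x) ((T ^^ m) x) \<le> \<epsilon>"
      using trapped[of n "m - n"] by simp
  qed
qed

lemma orbit_zero_Cauchy:
  assumes "x \<in> X"
  shows "zero_Cauchy X qp (\<lambda>n. (T ^^ n) x)"
proof -
  have small: "\<exists>K. \<forall>m\<ge>K. \<forall>n\<ge>K. dist (qp ((T ^^ n) x) ((T ^^ m) x)) 0 < \<epsilon>" if "\<epsilon> > 0" for \<epsilon>
  proof -
    have "\<epsilon> / 2 > 0" using that by simp
    obtain K1 where K1: "\<And>n m. \<lbrakk>K1 \<le> n; n \<le> m\<rbrakk> \<Longrightarrow> qp ((T ^^ n) x) ((T ^^ m) x) \<le> \<epsilon> / 2"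
      using orbit_eventually_trapped[OF assms \<open>\<epsilon> / 2 > 0\<close>] by blast
    obtain K2 where K2: "\<And>n m. \<lbrakk>K2 \<le> n; n \<le> m\<rbrakk> \<Longrightarrow> qp ((T ^^ m) x) ((T ^^ n) x) \<le> \<epsilon> / 2"
      using gauge_contraction.orbit_eventually_trapped[OF swap assms \<open>\<epsilon> / 2 > 0\<close>] by blast
    have "dist (qp ((T ^^ n) x) ((T ^^ m) x)) 0 < \<epsilon>" if "max K1 K2 \<le> n" "max K1 K2 \<le> m" for n m
    proof -
      have "qp ((T ^^ n) x) ((T ^^ m) x) \<le> \<epsilon> / 2"
        using K1[of n m] K2[of m n] that by (cases "n \<le> m") auto
      then show ?thesis
        using \<open>\<epsilon> > 0\<close> nonneg[OF iterate_in[OF assms] iterate_in[OF assms], of n m] by simp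
    qed
    then show ?thesis by blast
  qed
  show ?thesis
    unfolding zero_Cauchy_def tendsto_iff eventually_prod_sequentially
    using small iterate_in[OF assms] by (fastforce simp: case_prod_beta)
qed

lemma fixed_point_unique:
  assumes "x \<in> X" "T x = x" "y \<in> X" "T y = y"
  shows "x = y"
  using contraction[of x y] gauge_less[of "qp x y"] nonneg[of x y] eq_if_zero[of x y] assms
  by fastforce

lemma fixed_point_exists:
  assumes "zero_complete X qp"
  obtains l where "l \<in> X" "T l = l"
proof -
  obtain x where "x \<in> X" using nonempty by blast
  let ?x = "\<lambda>n. (T ^^ n) x"
  obtain l where "l \<in> X" and to_l: "(\<lambda>n. qp (?x n) l) \<longlonglongrightarrow> 0" and from_l: "(\<lambda>n. qp l (?x n)) \<longlonglongrightarrow> 0"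
    using assms orbit_zero_Cauchy[OF \<open>x \<in> X\<close>] unfolding zero_complete_def by fastforce
  have "T l \<in> X" using \<open>l \<in> X\<close> self_map by auto
  have "qp l (T l) \<le> s * (qp l (?x (Suc n)) + qp (?x n) l)" for n
  proof -
    have "qp l (T l) \<le> s * (qp l (?x (Suc n)) + qp (?x (Suc n)) (T l))"
      using \<open>l \<in> X\<close> \<open>T l \<in> X\<close> iterate_in[OF \<open>x \<in> X\<close>] by (intro relaxed_triangle)
    also have "\<dots> \<le> s * (qp l (?x (Suc n)) + qp (?x n) l)"
      using nonexpansive[OF iterate_in[OF \<open>x \<in> X\<close>] \<open>l \<in> X\<close>, of n] coeff_ge_1
      by (intro mult_left_mono) auto
    finally show ?thesis .
  qed
  moreover have "(\<lambda>n. s * (qp l (?x (Suc n)) + qp (?x n) l)) \<longlonglongrightarrow> s * (0 + 0)"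
    by (intro tendsto_intros to_l LIMSEQ_Suc[OF from_l])
  ultimately have "qp l (T l) \<le> 0"
    using LIMSEQ_le_const by fastforce
  then have "l = T l"
    using eq_if_zero[of l "T l"] nonneg[of l "T l"] \<open>l \<in> X\<close> \<open>T l \<in> X\<close> by simp
  then show ?thesis using that \<open>l \<in> X\<close> by simp
qed

end

theorem theorem4p2:
  fixes X :: "'a set" and qp :: "'a \<Rightarrow> 'a \<Rightarrow> real" and s :: real
    and T :: "'a \<Rightarrow> 'a" and \<phi> :: "real \<Rightarrow> real"
  assumes "quasi_partial_b_metric_like X qp s"
    and "zero_complete X qp"
    and "T \<in> X \<rightarrow> X"
    and "\<phi> \<in> {0..} \<rightarrow> {0..}"
    and "continuous_on {0..} \<phi>"
    and "\<And>t. t \<ge> 0 \<Longrightarrow> \<phi> t = 0 \<longleftrightarrow> t = 0"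
    and "\<And>t. t > 0 \<Longrightarrow> \<phi> t < t"
    and "\<And>x y. x \<in> X \<Longrightarrow> y \<in> X \<Longrightarrow> qp (T x) (T y) \<le> \<phi> (qp x y)"
    and "\<And>t. t > 0 \<Longrightarrow> summable (\<lambda>n. s ^ Suc n * (\<phi> ^^ Suc n) t)"
  shows "\<exists>!x. x \<in> X \<and> T x = x"
proof -
  interpret quasi_partial_b_metric_like X qp s
    by fact
  interpret gauge_contraction X qp s T \<phi>
    using assms(3,5-8) by unfold_locales auto
  show ?thesis
    using fixed_point_exists[OF assms(2)] fixed_point_unique by metis
qed

end
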